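(* For any integer $k\ge 2$, $b_k(3)\ge \binom{k+2}{2}-2$.
   Context: All matroids are finite. A line, hyperplane of a matroid $M$ is a flat of rank $2$, rank $r(M)-1$ respectively. Two sets $X,Y$ are skew in $M$ if $r_M(X\cup Y)=r_M(X)+r_M(Y)$. A 2-colouring of a simple matroid $M$ is a partition $(R,B)$ of $E(M)$ into red elements $R$ and blue elements $B$. For integers $k,t\ge 1$, $b_k(t)$ is the largest number $n$ for which there exists a simple rank-$(k+1)$ real-representable matroid $M$ with a 2-colouring $(R,B)$ with $|R|=t$, $|B|=n$ such that: (C1) $r_M(B)\ge 2$; (C2) $H\cap R\ne\emptyset$ for every hyperplane $H$ of $M$; (C3) for every line $L$ of $M|B$ there is a rank-$(k-1)$ flat $F$ of $M$ skew to $L$ with $F\cap R=\emptyset$. If no such $n$ exists, $b_k(t)=0$. (The maximum is finite for all $k,t\ge 1$.) *)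

theory Defs
  imports Complex_Main
begin

locale matroid =
  fixes E :: "'a set" and indep :: "'a set \<Rightarrow> bool"
  assumes finite_ground: "finite E"
    and indep_subset_ground: "indep X \<Longrightarrow> X \<subseteq> E"
    and indep_empty: "indep {}"
    and indep_subset: "indep X \<Longrightarrow> Y \<subseteq> X \<Longrightarrow> indep Y"
    and indep_augment: "indep X \<Longrightarrow> indep Y \<Longrightarrow> card X < card Y \<Longrightarrow> \<exists>y\<in>Y - X. indep (insert y X)"
begin

definition rank :: "'a set \<Rightarrow> nat" where
  "rank X = Max (card ` {I. I \<subseteq> X \<and> indep I})"

definition flat :: "'a set \<Rightarrow> bool" where
  "flat F \<longleftrightarrow> F \<subseteq> E \<and> (\<forall>x\<in>E - F. rank F < rank (insert x F))"

definition line :: "'a set \<Rightarrow> bool" where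
  "line L \<longleftrightarrow> flat L \<and> rank L = 2"

definition hyperplane :: "'a set \<Rightarrow> bool" where
  "hyperplane H \<longleftrightarrow> flat H \<and> rank H + 1 = rank E"

definition skew :: "'a set \<Rightarrow> 'a set \<Rightarrow> bool" where
  "skew X Y \<longleftrightarrow> rank (X \<union> Y) = rank X + rank Y"

(* Taking x = y excludes loops, x \<noteq> y excludes parallel pairs. *)
definition simple :: bool where
  "simple \<longleftrightarrow> (\<forall>x\<in>E. \<forall>y\<in>E. indep {x, y})"

(* Independent sets of the restriction to A, whose ground set is A. *)
definition restrict_indep :: "'a set \<Rightarrow> 'a set \<Rightarrow> bool" where
  "restrict_indep A X \<longleftrightarrow> X \<subseteq> A \<and> indep X"

(* v x i is the entry in row i and column x of a real matrix with m rows and columns indexed by E;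
   the right-hand side says that the family of columns indexed by X is linearly independent
   (so equal columns at distinct indices are dependent). *)
definition real_representable :: bool where
  "real_representable \<longleftrightarrow>
    (\<exists>(m::nat) (v :: 'a \<Rightarrow> nat \<Rightarrow> real). \<forall>X\<subseteq>E.
       indep X \<longleftrightarrow> (\<forall>c. (\<forall>i<m. (\<Sum>x\<in>X. c x * v x i) = 0) \<longrightarrow> (\<forall>x\<in>X. c x = 0)))"

definition two_colouring :: "'a set \<Rightarrow> 'a set \<Rightarrow> bool" where
  "two_colouring R B \<longleftrightarrow> R \<union> B = E \<and> R \<inter> B = {}"

definition C1 :: "'a set \<Rightarrow> bool" where
  "C1 B \<longleftrightarrow> rank B \<ge> 2"

definition C2 :: "'a set \<Rightarrow> bool" where
  "C2 R \<longleftrightarrow> (\<forall>H. hyperplane H \<longrightarrow> H \<inter> R \<noteq> {})"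

definition C3 :: "nat \<Rightarrow> 'a set \<Rightarrow> 'a set \<Rightarrow> bool" where
  "C3 k R B \<longleftrightarrow>
    (\<forall>L. matroid.line B (restrict_indep B) L \<longrightarrow>
       (\<exists>F. flat F \<and> rank F = k - 1 \<and> skew F L \<and> F \<inter> R = {}))"

end

(* Every finite matroid is isomorphic to one whose ground set consists of natural numbers,
   so it is enough to range over these. *)
definition blue_count :: "nat \<Rightarrow> nat \<Rightarrow> nat \<Rightarrow> bool" where
  "blue_count k t n \<longleftrightarrow>
    (\<exists>(E :: nat set) indep R B.
       matroid E indep \<and> matroid.simple E indep \<and> matroid.rank indep E = k + 1 \<and>
       matroid.real_representable E indep \<and> matroid.two_colouring E R B \<and>
       card R = t \<and> card B = n \<and>
       matroid.C1 indep B \<and> matroid.C2 E indep R \<and> matroid.C3 E indep k R B)"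

(* Intended for k, t \<ge> 1, where only finitely many n satisfy blue_count k t n. *)
definition b_num :: "nat \<Rightarrow> nat \<Rightarrow> nat" where
  "b_num k t = (if \<exists>n. blue_count k t n then (GREATEST n. blue_count k t n) else 0)"

end

theory Submission
  imports Defs "HOL-Library.Function_Algebras" "HOL-Library.Nat_Bijection"
begin

text \<open>
  Since b is defined through a greatest element, two things are needed: a matroid attaining the value,
  and an upper bound on the number of blue points.

  Matroid: take the cycle matroid of the complete graph on the vertices 0, ..., k + 1, colour the edges
  01 and 23 red, and add the red point $r = e_0 + e_1 - e_2 - e_3$. A hyperplane avoiding r
  corresponds to a partition of the vertices into two classes. If it also avoids both red edges, then
  0, 1 and 2, 3 lie in different classes, hence it contains 02 and 13, or 03 and 12, and so r. Given
  a blue line, one can 3-colour the vertices such that the line has rank 2 modulo the monochromatic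
  edges and these do not span a red point; they form the required flat of rank $k - 1$.

  Bound: a set S has at most $t^{r(S)}$ blue points. If x and y are distinct blue points of S and F is a
  flat of rank $k - 1$ skew to their line and without red points, then every hyperplane through F is
  spanned by F and one of the t red points. So t hyperplanes cover S, and none of them contains both
  x and y, so that each meets S in a set of smaller rank.
\<close>

section \<open>Rank and an upper bound on the number of blue points\<close>

context matroid
begin

section \<open>Ranks, bases and monotonicity\<close>

lemma indep_finite: "indep X \<Longrightarrow> finite X"
  using indep_subset_ground finite_ground finite_subset by blast

lemma finite_ranks: "finite (card ` {I. I \<subseteq> X \<and> indep I})"
proof -
  have "{I. I \<subseteq> X \<and> indep I} \<subseteq> Pow E"
    using indep_subset_ground by auto
  then show ?thesis
    using finite_ground by (meson finite_Pow_iff finite_imageI finite_subset)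
qed

lemma card_le_rank: "indep I \<Longrightarrow> I \<subseteq> X \<Longrightarrow> card I \<le> rank X"
  unfolding rank_def by (rule Max_ge[OF finite_ranks]) auto

lemma basis_exists:
  obtains I where "I \<subseteq> X" "indep I" "card I = rank X"
proof -
  have "rank X \<in> card ` {I. I \<subseteq> X \<and> indep I}"
    unfolding rank_def by (rule Max_in[OF finite_ranks]) (use indep_empty in auto)
  then show ?thesis
    using that by auto
qed

lemma rank_mono:
  assumes "X \<subseteq> Y"
  shows "rank X \<le> rank Y"
  by (metis assms basis_exists card_le_rank order_trans)

lemma rank_indep:
  assumes "indep X"
  shows "rank X = card X"
proof (rule antisym)
  obtain I where "I \<subseteq> X" "card I = rank X"
    by (rule basis_exists)
  then show "rank X \<le> card X"
    using card_mono indep_finite[OF assms] by metis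
qed (simp add: assms card_le_rank)

lemma extend_to_basis:
  assumes "indep I" "I \<subseteq> X"
  obtains J where "I \<subseteq> J" "J \<subseteq> X" "indep J" "card J = rank X"
proof -
  have "\<exists>J. I \<subseteq> J \<and> J \<subseteq> X \<and> indep J \<and> card J = rank X"
    using assms
  proof (induction "rank X - card I" arbitrary: I)
    case 0
    then show ?case
      using card_le_rank[of I X] by (intro exI[of _ I]) simp
  next
    case (Suc n)
    obtain B where B: "B \<subseteq> X" "indep B" "card B = rank X"
      by (rule basis_exists)
    moreover have "card I < card B"
      using Suc(2) B(3) by simp
    ultimately obtain y where y: "y \<in> B - I" "indep (insert y I)"
      using indep_augment[of I B] Suc(3) by blast
    have "n = rank X - card (insert y I)"
      using Suc(2) y(1) indep_finite[OF Suc(3)] by simp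
    moreover have "insert y I \<subseteq> X"
      using y(1) Suc(4) B(1) by auto
    ultimately have "\<exists>J. insert y I \<subseteq> J \<and> J \<subseteq> X \<and> indep J \<and> card J = rank X"
      using Suc(1)[of "insert y I"] y(2) by simp
    then show ?case
      by auto
  qed
  then show ?thesis
    using that by blast
qed

lemma rank_insert_le: "rank (insert x X) \<le> rank X + 1"
proof -
  obtain J where J: "J \<subseteq> insert x X" "indep J" "card J = rank (insert x X)"
    by (rule basis_exists)
  have "card (J - {x}) \<le> rank X"
    by (rule card_le_rank) (use J indep_subset[of J] in auto)
  then show ?thesis
    using J card_Diff1_le[of J x] card_Diff_singleton_if[of J x] by (auto split: if_splits)
qed

text \<open>Otherwise a basis of \<open>X\<close> could be augmented from a basis of the union by
  some \<open>y\<close>, and this \<open>y\<close> alone would already raise the rank of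
  \<open>X\<close>.\<close>

lemma rank_union_eq:
  assumes "\<And>y. y \<in> Y \<Longrightarrow> rank (insert y X) = rank X"
  shows "rank (X \<union> Y) = rank X"
proof (rule ccontr)
  assume "rank (X \<union> Y) \<noteq> rank X"
  then have less: "rank X < rank (X \<union> Y)"
    using rank_mono[of X "X \<union> Y"] by simp
  obtain I where I: "I \<subseteq> X" "indep I" "card I = rank X"
    by (rule basis_exists)
  obtain J where J: "J \<subseteq> X \<union> Y" "indep J" "card J = rank (X \<union> Y)"
    by (rule basis_exists)
  obtain y where y: "y \<in> J - I" "indep (insert y I)"
    using indep_augment[of I J] I J less by auto
  have "card (insert y I) \<le> rank (insert y X)"
    using y I by (intro card_le_rank) auto
  moreover have "rank (insert y X) = rank X"
    using assms y J(1) by (cases "y \<in> X") (auto simp: insert_absorb)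
  ultimately show False
    using I(3) y(1) indep_finite[OF I(2)] by simp
qed

text \<open>A basis of \<open>X\<close> extends to one of \<open>Y\<close>. If \<open>x\<close>
  raised the rank of \<open>Y\<close>, augmentation could only add \<open>x\<close> to it, so
  \<open>x\<close> would also be independent of the basis of \<open>X\<close>.\<close>

lemma rank_insert_eq_mono:
  assumes "rank (insert x X) = rank X" "X \<subseteq> Y"
  shows "rank (insert x Y) = rank Y"
proof (rule ccontr)
  assume "rank (insert x Y) \<noteq> rank Y"
  then have less: "rank Y < rank (insert x Y)"
    using rank_mono[OF subset_insertI[of Y x]] by simp
  obtain I where I: "I \<subseteq> X" "indep I" "card I = rank X"
    by (rule basis_exists)
  obtain J where J: "I \<subseteq> J" "J \<subseteq> Y" "indep J" "card J = rank Y"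
    using extend_to_basis[OF I(2), of Y] I(1) assms(2) by blast
  obtain K where K: "K \<subseteq> insert x Y" "indep K" "card K = rank (insert x Y)"
    by (rule basis_exists)
  obtain y where y: "y \<in> K - J" "indep (insert y J)"
    using indep_augment[of J K] J K less by auto
  have "card (insert y J) = card J + 1"
    using y indep_finite[OF J(3)] by simp
  then have "y \<notin> Y"
    using card_le_rank[OF y(2), of Y] J by auto
  with y K have "y = x"
    by auto
  then have "indep (insert x I)"
    using y(2) J(1) by (auto intro: indep_subset)
  then have "card (insert x I) \<le> rank (insert x X)"
    using I(1) by (intro card_le_rank) auto
  moreover have "x \<notin> I"
    using \<open>y = x\<close> y J(1) by auto
  ultimately show False
    using assms(1) I(3) indep_finite[OF I(2)] by simp
qed

text \<open>Since \<open>A\<close> spans \<open>S\<close>, no element of \<open>S\<close> raises the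
  rank of \<open>A\<close>. By monotonicity none raises that of \<open>H\<close>, and a flat
  contains all such elements.\<close>

lemma flat_superset:
  assumes "flat H" "A \<subseteq> H" "A \<subseteq> S" "S \<subseteq> E" "rank S \<le> rank A"
  shows "S \<subseteq> H"
proof
  fix s
  assume s: "s \<in> S"
  have "rank (insert s A) = rank A"
    using rank_mono[of "insert s A" S] rank_mono[OF subset_insertI[of A s]] s assms by auto
  then have "rank (insert s H) = rank H"
    using assms(2) by (rule rank_insert_eq_mono)
  then show "s \<in> H"
    using assms(1,4) s unfolding flat_def by force
qed

section \<open>Closures, restrictions and lines\<close>

definition closure_of :: "'a set \<Rightarrow> 'a set" where
  "closure_of X = {x \<in> E. rank (insert x X) = rank X}"

lemma closure_of_superset: "X \<subseteq> E \<Longrightarrow> X \<subseteq> closure_of X"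
  unfolding closure_of_def by (auto simp: insert_absorb)

lemma rank_closure_of:
  assumes "X \<subseteq> E"
  shows "rank (closure_of X) = rank X"
proof -
  have "rank (X \<union> closure_of X) = rank X"
    by (rule rank_union_eq) (simp add: closure_of_def)
  then show ?thesis
    using closure_of_superset[OF assms] by (simp add: Un_absorb1)
qed

lemma flat_closure_of:
  assumes "X \<subseteq> E"
  shows "flat (closure_of X)"
  unfolding flat_def
proof (intro conjI ballI)
  show "closure_of X \<subseteq> E"
    by (auto simp: closure_of_def)
  fix x
  assume "x \<in> E - closure_of X"
  then have "rank X < rank (insert x X)"
    using rank_mono[OF subset_insertI[of X x]] by (auto simp: closure_of_def)
  also have "\<dots> \<le> rank (insert x (closure_of X))"
    using closure_of_superset[OF assms] by (intro rank_mono) auto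
  finally show "rank (closure_of X) < rank (insert x (closure_of X))"
    by (simp add: rank_closure_of assms)
qed

lemma rank_insert_flat:
  assumes "flat F" "x \<in> E - F"
  shows "rank (insert x F) = rank F + 1"
  using assms rank_insert_le[of x F] unfolding flat_def by (intro antisym) (auto simp: Suc_le_eq)

lemma matroid_restrict:
  assumes "A \<subseteq> E"
  shows "matroid A (restrict_indep A)"
proof
  show "finite A"
    using assms finite_ground by (rule finite_subset)
next
  fix X Y
  assume "restrict_indep A X" "restrict_indep A Y" "card X < card Y"
  then show "\<exists>y\<in>Y - X. restrict_indep A (insert y X)"
    using indep_augment[of X Y] unfolding restrict_indep_def by auto
qed (auto simp: restrict_indep_def indep_empty intro: indep_subset)

lemma restrict_rank:
  assumes "A \<subseteq> E" "X \<subseteq> A"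
  shows "matroid.rank (restrict_indep A) X = rank X"
proof -
  have "{I. I \<subseteq> X \<and> restrict_indep A I} = {I. I \<subseteq> X \<and> indep I}"
    using assms by (auto simp: restrict_indep_def)
  then show ?thesis
    by (simp add: matroid.rank_def[OF matroid_restrict[OF assms(1)]] rank_def)
qed

text \<open>\<open>C3\<close> speaks of lines of the restriction, so the closure is formed inside
  \<open>B\<close>; ranks of subsets of \<open>B\<close> agree in both matroids.\<close>

lemma restrict_line_through:
  assumes "B \<subseteq> E" "x \<in> B" "y \<in> B" "rank {x, y} = 2"
  obtains L where "matroid.line B (restrict_indep B) L" "{x, y} \<subseteq> L" "L \<subseteq> B" "rank L = 2"
proof -
  interpret B: matroid B "restrict_indep B"
    using assms(1) by (rule matroid_restrict)
  let ?L = "B.closure_of {x, y}"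
  have xy: "{x, y} \<subseteq> B"
    using assms by auto
  have sub: "?L \<subseteq> B"
    by (auto simp: B.closure_of_def)
  have rank: "B.rank ?L = 2"
    using xy assms by (simp add: B.rank_closure_of restrict_rank)
  show ?thesis
  proof
    show "B.line ?L"
      using xy rank by (simp add: B.line_def B.flat_closure_of)
    show "{x, y} \<subseteq> ?L"
      using xy by (rule B.closure_of_superset)
    show "rank ?L = 2"
      using rank restrict_rank[OF assms(1) sub] by simp
  qed (rule sub)
qed

section \<open>Covering by hyperplanes and the resulting bound\<close>

text \<open>For \<open>x\<close> outside \<open>F\<close>, the closure of \<open>insert x F\<close>
  is a hyperplane and so contains some red \<open>r\<close>. As \<open>r\<close> is not in
  \<open>F\<close>, it spans the same hyperplane together with \<open>F\<close>.\<close>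

lemma hyperplanes_cover:
  assumes C2: "C2 R" and F: "flat F" "rank F + 2 = rank E" "F \<inter> R = {}" and R: "R \<subseteq> E"
  shows "E \<subseteq> F \<union> (\<Union>r\<in>R. closure_of (insert r F))"
proof
  fix x
  assume x: "x \<in> E"
  have FE: "F \<subseteq> E"
    using F by (simp add: flat_def)
  show "x \<in> F \<union> (\<Union>r\<in>R. closure_of (insert r F))"
  proof (cases "x \<in> F")
    case False
    let ?H = "closure_of (insert x F)"
    have xF: "insert x F \<subseteq> E"
      using x FE by simp
    have rankH: "rank ?H = rank F + 1"
      using rank_closure_of[OF xF] rank_insert_flat[OF F(1)] x False by simp
    then have "hyperplane ?H"
      using F(2) flat_closure_of[OF xF] by (simp add: hyperplane_def)
    then obtain r where r: "r \<in> ?H" "r \<in> R"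
      using C2 by (auto simp: C2_def)
    have rF: "insert r F \<subseteq> E" "r \<in> E - F"
      using r R FE F(3) by auto
    have "?H \<subseteq> closure_of (insert r F)"
    proof (rule flat_superset)
      show "insert r F \<subseteq> ?H"
        using r closure_of_superset[OF xF] by auto
      show "rank ?H \<le> rank (insert r F)"
        using rankH rank_insert_flat[OF F(1) rF(2)] by simp
      show "?H \<subseteq> E"
        by (auto simp: closure_of_def)
    qed (use rF in \<open>auto simp: flat_closure_of intro: closure_of_superset[THEN subsetD]\<close>)
    then show ?thesis
      using closure_of_superset[OF xF] r by auto
  qed simp
qed

lemma card_blue_le:
  assumes simple: simple and col: "two_colouring R B" and rk: "rank E = k + 1"
    and C2: "C2 R" and C3: "C3 k R B" and k: "k \<ge> 1" and "R \<noteq> {}" and "S \<subseteq> E"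
  shows "card (S \<inter> B) \<le> card R ^ rank S"
  using \<open>S \<subseteq> E\<close>
proof (induction "rank S" arbitrary: S rule: less_induct)
  case less
  have RB: "R \<subseteq> E" "B \<subseteq> E" "finite R" "finite B"
    using col finite_ground finite_subset by (auto simp: two_colouring_def)
  have R1: "card R \<ge> 1"
    using \<open>R \<noteq> {}\<close> RB(3) by (simp add: Suc_le_eq card_gt_0_iff)
  show ?case
  proof (cases "\<exists>x\<in>S \<inter> B. \<exists>y\<in>S \<inter> B. x \<noteq> y")
    case False
    then have "card (S \<inter> B) \<le> 1"
      using card_le_Suc0_iff_eq[of "S \<inter> B"] RB(4) by auto
    also have "\<dots> \<le> card R ^ rank S"
      using R1 by simp
    finally show ?thesis .
  next
    case True
    then obtain x y where xy: "x \<in> S \<inter> B" "y \<in> S \<inter> B" "x \<noteq> y"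
      by blast
    have rxy: "rank {x, y} = 2"
      using simple xy RB(2) rank_indep[of "{x, y}"] unfolding simple_def by (simp add: subset_iff)
    obtain L where L: "matroid.line B (restrict_indep B) L" "{x, y} \<subseteq> L" "L \<subseteq> B" "rank L = 2"
      using restrict_line_through[OF RB(2) _ _ rxy] xy by auto
    obtain F where F: "flat F" "rank F = k - 1" "skew F L" "F \<inter> R = {}"
      using C3 L(1) by (auto simp: C3_def)
    have FE: "F \<subseteq> E"
      using F by (simp add: flat_def)
    define H where "H r = closure_of (insert r F)" for r
    \<comment> \<open>If the rank did not drop, \<open>H r\<close> would contain \<open>S\<close>,
      hence \<open>L\<close> as well as \<open>F\<close>. By skewness its rank would be at least
      \<open>rank F + 2\<close>, but it is at most \<open>rank F + 1\<close>.\<close>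
    have small: "rank (S \<inter> H r) < rank S" if "r \<in> R" for r
    proof (rule ccontr)
      assume "\<not> ?thesis"
      then have "rank S \<le> rank (S \<inter> H r)"
        by simp
      have rF: "insert r F \<subseteq> E"
        using that RB FE by auto
      have flatH: "flat (H r)"
        unfolding H_def using rF by (rule flat_closure_of)
      have "S \<subseteq> H r"
        by (rule flat_superset[OF flatH _ _ less(2) \<open>rank S \<le> rank (S \<inter> H r)\<close>]) auto
      then have "{x, y} \<subseteq> H r"
        using xy by auto
      then have "L \<subseteq> H r"
        using flat_superset[OF flatH, of "{x, y}" L] L rxy RB by auto
      moreover have "F \<subseteq> H r"
        using closure_of_superset[OF rF] by (auto simp: H_def)
      ultimately have "rank (F \<union> L) \<le> rank (H r)"
        by (intro rank_mono) auto
      also have "\<dots> = rank (insert r F)"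
        unfolding H_def using rF by (rule rank_closure_of)
      also have "\<dots> \<le> rank F + 1"
        by (rule rank_insert_le)
      finally show False
        using F(3) L(4) by (simp add: skew_def)
    qed
    have FH: "F \<subseteq> H r" if "r \<in> R" for r
      using closure_of_superset[of "insert r F"] that RB FE by (auto simp: H_def)
    have "E \<subseteq> F \<union> (\<Union>r\<in>R. H r)"
      unfolding H_def by (rule hyperplanes_cover) (use C2 F RB rk k in auto)
    also have "\<dots> = (\<Union>r\<in>R. H r)"
      using FH \<open>R \<noteq> {}\<close> by auto
    finally have "S \<inter> B \<subseteq> (\<Union>r\<in>R. (S \<inter> H r) \<inter> B)"
      using less(2) by auto
    then have "card (S \<inter> B) \<le> card (\<Union>r\<in>R. (S \<inter> H r) \<inter> B)"
      using RB by (intro card_mono) auto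
    also have "\<dots> \<le> (\<Sum>r\<in>R. card ((S \<inter> H r) \<inter> B))"
      using RB(3) by (rule card_UN_le)
    also have "\<dots> \<le> (\<Sum>r\<in>R. card R ^ (rank S - 1))"
    proof (rule sum_mono)
      fix r
      assume r: "r \<in> R"
      have "card ((S \<inter> H r) \<inter> B) \<le> card R ^ rank (S \<inter> H r)"
        using less small[OF r] by auto
      also have "\<dots> \<le> card R ^ (rank S - 1)"
        using small[OF r] R1 by (intro power_increasing) auto
      finally show "card ((S \<inter> H r) \<inter> B) \<le> card R ^ (rank S - 1)" .
    qed
    \<comment> \<open>The points \<open>x\<close> and \<open>y\<close> give
      \<open>rank S \<ge> 2\<close>, so \<open>rank S - 1\<close> is a true predecessor.\<close>
    also have "\<dots> = card R ^ rank S"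
      using rank_mono[of "{x, y}" S] rxy xy by (cases "rank S") auto
    finally show ?thesis .
  qed
qed

end

lemma blue_count_bounded:
  assumes "blue_count k t n" "k \<ge> 1" "t \<ge> 1"
  shows "n \<le> t ^ (k + 1)"
proof -
  obtain E :: "nat set" and indep R B where *:
    "matroid E indep" "matroid.simple E indep" "matroid.rank indep E = k + 1"
    "matroid.two_colouring E R B" "card R = t" "card B = n" "matroid.C2 E indep R"
    "matroid.C3 E indep k R B"
    using assms(1) unfolding blue_count_def by blast
  interpret matroid E indep
    by (rule *(1))
  have "card (E \<inter> B) \<le> card R ^ rank E"
    using * assms by (intro card_blue_le) auto
  moreover have "E \<inter> B = B"
    using *(4) by (auto simp: two_colouring_def)
  ultimately show ?thesis
    using * by simp
qed

lemma b_num_ge: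
  assumes "blue_count k t n" "k \<ge> 1" "t \<ge> 1"
  shows "n \<le> b_num k t"
proof -
  have "n \<le> (GREATEST m. blue_count k t m)"
    using assms(1) by (rule Greatest_le_nat) (use blue_count_bounded assms(2,3) in blast)
  then show ?thesis
    using assms(1) by (auto simp: b_num_def)
qed

section \<open>Matroids of vector families\<close>

context vector_space
begin

text \<open>Connects independence of sets of vectors with that of indexed families, as used in
  \<open>real_representable\<close>; injectivity accounts for repeated columns.\<close>

lemma independent_family_iff:
  assumes "finite X"
  shows "inj_on v X \<and> \<not> dependent (v ` X) \<longleftrightarrow>
    (\<forall>c. (\<Sum>x\<in>X. scale (c x) (v x)) = 0 \<longrightarrow> (\<forall>x\<in>X. c x = 0))"
    (is "?L \<longleftrightarrow> ?R")
proof
  assume L: ?L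
  show ?R
  proof (intro allI impI ballI)
    fix c x
    assume c: "(\<Sum>x\<in>X. scale (c x) (v x)) = 0" and x: "x \<in> X"
    let ?u = "\<lambda>w. c (inv_into X v w)"
    have "(\<Sum>w\<in>v ` X. scale (?u w) w) = (\<Sum>x\<in>X. scale (c x) (v x))"
      using L by (subst sum.reindex) (auto intro!: sum.cong)
    then have "?u (v x) = 0"
      using L assms x c by (intro independentD[of "v ` X" "v ` X" ?u]) auto
    then show "c x = 0"
      using L x by simp
  qed
next
  assume R: ?R
  have inj: "inj_on v X"
  proof (rule inj_onI, rule ccontr)
    fix x y
    assume xy: "x \<in> X" "y \<in> X" "v x = v y" "x \<noteq> y"
    \<comment> \<open>A repeated vector yields the relation \<open>v x - v y = 0\<close>.\<close>
    define c :: "'c \<Rightarrow> 'a" where "c z = (if z = x then 1 else if z = y then - 1 else 0)" for z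
    have "(\<Sum>z\<in>X. scale (c z) (v z)) = (\<Sum>z\<in>{x, y}. scale (c z) (v z))"
      using assms xy by (intro sum.mono_neutral_right) (auto simp: c_def)
    also have "\<dots> = 0"
      using xy by (simp add: c_def)
    finally have "c x = 0"
      using R xy(1) by blast
    then show False
      by (simp add: c_def)
  qed
  moreover have "\<not> dependent (v ` X)"
  proof (rule independent_if_scalars_zero)
    fix f w
    assume f: "(\<Sum>w\<in>v ` X. scale (f w) w) = 0" and w: "w \<in> v ` X"
    have "(\<Sum>x\<in>X. scale (f (v x)) (v x)) = 0"
      using f inj by (simp add: sum.reindex)
    then have "\<forall>x\<in>X. f (v x) = 0"
      using R[rule_format, of "\<lambda>x. f (v x)"] by simp
    with w show "f w = 0"
      by auto
  qed (use assms in simp)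
  ultimately show ?L ..
qed

end

locale column_matroid = vector_space scale
  for scale :: "'a::field \<Rightarrow> 'b::ab_group_add \<Rightarrow> 'b" (infixr "*s" 75) +
  fixes E :: "'i set" and v :: "'i \<Rightarrow> 'b"
  assumes finite_columns: "finite E"
begin

definition column_indep :: "'i set \<Rightarrow> bool" where
  "column_indep X \<longleftrightarrow> X \<subseteq> E \<and> inj_on v X \<and> \<not> dependent (v ` X)"

lemma column_indep_insert:
  assumes "x \<notin> X"
  shows "column_indep (insert x X) \<longleftrightarrow> x \<in> E \<and> column_indep X \<and> v x \<notin> span (v ` X)"
proof -
  have "v x \<in> span (v ` X)" if "v x \<in> v ` X"
    using that by (rule span_base)
  then show ?thesis
    using assms by (auto simp: column_indep_def independent_insert)
qed

sublocale matroid E column_indep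
proof
  show "finite E"
    by (rule finite_columns)
next
  fix X Y
  assume XY: "column_indep X" "column_indep Y" "card X < card Y"
  then have "finite X" "finite Y"
    using finite_columns finite_subset by (auto simp: column_indep_def)
  \<comment> \<open>By Steinitz, independent columns inside the span of the columns of
    \<open>X\<close> number at most \<open>card X\<close>, so some column of \<open>Y\<close> lies
    outside this span.\<close>
  have "\<not> v ` Y \<subseteq> span (v ` X)"
  proof
    assume "v ` Y \<subseteq> span (v ` X)"
    then have "card (v ` Y) \<le> card (v ` X)"
      using independent_span_bound[of "v ` X" "v ` Y"] XY \<open>finite X\<close>
      by (simp add: column_indep_def)
    then show False
      using XY by (simp add: column_indep_def card_image)
  qed
  then obtain y where y: "y \<in> Y" "v y \<notin> span (v ` X)"
    by auto
  then have "y \<notin> X"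
    by (auto intro: span_base)
  moreover have "y \<in> E"
    using y(1) XY(2) by (auto simp: column_indep_def)
  ultimately show "\<exists>y\<in>Y - X. column_indep (insert y X)"
    using y XY(1) by (intro bexI[of _ y]) (simp_all add: column_indep_insert)
next
  fix X Y
  assume "column_indep X" "Y \<subseteq> X"
  then show "column_indep Y"
    unfolding column_indep_def
    by (meson image_mono independent_mono inj_on_subset order_trans)
qed (auto simp: column_indep_def independent_empty)

text \<open>Turns rank computations into span membership. A basis of \<open>X\<close> spans all
  columns of \<open>X\<close>, since a column outside its span would enlarge it.\<close>

lemma rank_insert_columns:
  assumes "X \<subseteq> E" "x \<in> E"
  shows "rank (insert x X) =
    rank X + of_bool (v x \<notin> span (v ` X))"
proof -
  obtain I where I: "I \<subseteq> X" "column_indep I" "card I = rank X"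
    by (rule basis_exists)
  have finI: "finite I"
    using I(2) by (rule indep_finite)
  show ?thesis
  proof (cases "v x \<in> span (v ` X)")
    case False
    have "v x \<notin> span (v ` I)"
      using False I(1) span_mono[of "v ` I" "v ` X"] by auto
    moreover have "x \<notin> I"
      using calculation by (auto intro: span_base)
    ultimately have "column_indep (insert x I)"
      using I assms by (simp add: column_indep_insert)
    then have "card (insert x I) \<le> rank (insert x X)"
      using I(1) by (intro card_le_rank) auto
    then show ?thesis
      using False I(3) finI \<open>x \<notin> I\<close> rank_insert_le[of x X] by simp
  next
    case True
    have "v z \<in> span (v ` I)" if "z \<in> X" for z
    proof (cases "z \<in> I")
      case True
      then show ?thesis
        by (auto intro: span_base)
    next
      case False
      have "\<not> column_indep (insert z I)"
        using card_le_rank[of "insert z I" X] I that False finI by auto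
      then show ?thesis
        using False that assms I by (auto simp: column_indep_insert)
    qed
    then have sub: "v ` X \<subseteq> span (v ` I)"
      by auto
    then have "span (v ` X) \<subseteq> span (v ` I)"
      by (intro span_minimal) auto
    with True sub have ins: "v ` insert x X \<subseteq> span (v ` I)"
      by auto
    have "rank (insert x X) \<le> rank X"
    proof (rule ccontr)
      assume less: "\<not> rank (insert x X) \<le> rank X"
      obtain J where J: "J \<subseteq> insert x X" "column_indep J" "card J = rank (insert x X)"
        by (rule basis_exists)
      obtain y where "y \<in> J - I" "column_indep (insert y I)"
        using indep_augment[OF I(2) J(2)] I(3) J(3) less by auto
      then have "y \<in> J" "v y \<notin> span (v ` I)"
        by (auto simp: column_indep_insert)
      with ins J(1) show False
        by auto
    qed
    then show ?thesis
      using True rank_mono[OF subset_insertI[of X x]] by simp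
  qed
qed

end

section \<open>Real vectors and linear functionals\<close>

interpretation fn: vector_space "\<lambda>(c::real) (f :: nat \<Rightarrow> real) n. c * f n"
  by unfold_locales (auto simp: fun_eq_iff algebra_simps)

lemma sum_fun_apply: "sum f A x = (\<Sum>a\<in>A. f a x)"
  for f :: "'a \<Rightarrow> 'b \<Rightarrow> 'c::comm_monoid_add"
  by (induction A rule: infinite_finite_induct) auto

text \<open>Rows from \<open>m\<close> on vanish on all columns, so the first \<open>m\<close> rows
  decide every linear relation.\<close>

lemma real_representable_columns:
  fixes v :: "'i \<Rightarrow> nat \<Rightarrow> real"
  assumes "finite E" and supp: "\<And>x n. x \<in> E \<Longrightarrow> n \<ge> m \<Longrightarrow> v x n = 0"
  shows "matroid.real_representable E (column_matroid.column_indep (\<lambda>c f n. c * f n) E v)"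
proof -
  interpret column_matroid "\<lambda>(c::real) (f :: nat \<Rightarrow> real) n. c * f n" E v
    by unfold_locales (rule assms(1))
  have "column_indep X \<longleftrightarrow>
      (\<forall>c. (\<forall>i<m. (\<Sum>x\<in>X. c x * v x i) = 0) \<longrightarrow> (\<forall>x\<in>X. c x = 0))"
    if X: "X \<subseteq> E" for X
  proof -
    have "(\<forall>i<m. (\<Sum>x\<in>X. c x * v x i) = 0) \<longleftrightarrow> (\<Sum>x\<in>X. (\<lambda>n. c x * v x n)) = 0" for c
    proof -
      have "(\<Sum>x\<in>X. c x * v x i) = 0" if "i \<ge> m" for i
        using that X supp by (intro sum.neutral) auto
      then show ?thesis
        by (auto simp: fun_eq_iff sum_fun_apply) (meson not_le)
    qed
    then show ?thesis
      using fn.independent_family_iff[of X v] X finite_subset[OF X assms(1)]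
      by (simp add: column_indep_def)
  qed
  then show ?thesis
    unfolding real_representable_def by blast
qed

text \<open>Summing the coordinates in \<open>A\<close> is a linear functional. It serves as a
  certificate that a vector lies outside a span.\<close>

lemma sum_eq_0_on_span:
  assumes "w \<in> fn.span S" "\<And>u. u \<in> S \<Longrightarrow> sum u A = 0"
  shows "sum w A = 0"
proof -
  have "fn.subspace {w. sum w A = 0}"
    by (auto simp: fn.subspace_def sum.distrib simp flip: sum_distrib_left)
  then show ?thesis
    using fn.span_minimal[of S "{w. sum w A = 0}"] assms by auto
qed

section \<open>Separating 3-colourings\<close>

text \<open>The vertices 0, 1 and 2, 3 span the red edges. The first two inequalities keep these edges
  bichromatic; the last one keeps the extra red point out of the span of the monochromatic edges.\<close>

definition separating :: "(nat \<Rightarrow> nat) \<Rightarrow> bool" where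
  "separating f \<longleftrightarrow>
    (\<forall>n. f n \<in> {0, 1, 2}) \<and> f 0 \<noteq> f 1 \<and> f 2 \<noteq> f 3 \<and> {f 0, f 1} \<noteq> {f 2, f 3}"

lemma separating_upd:
  assumes "separating f" "q \<ge> 4" "c \<in> {0, 1, 2}"
  shows "separating (f(q := c))"
  using assms by (simp add: separating_def)

definition colouring4 :: "nat \<Rightarrow> nat \<Rightarrow> nat \<Rightarrow> nat \<Rightarrow> nat \<Rightarrow> nat" where
  "colouring4 a b c d n =
    (if n = 0 then a else if n = 1 then b else if n = 2 then c else if n = 3 then d else 0)"

lemma colouring4_simps [simp]:
  "colouring4 a b c d 0 = a" "colouring4 a b c d (Suc 0) = b" "colouring4 a b c d 1 = b"
  "colouring4 a b c d 2 = c" "colouring4 a b c d 3 = d"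
  by (auto simp: colouring4_def)

lemma separating_colouring4:
  assumes "{a, b, c, d} \<subseteq> {0, 1, 2}" "a \<noteq> b" "c \<noteq> d" "{a, b} \<noteq> {c, d}"
  shows "separating (colouring4 a b c d)"
  using assms unfolding separating_def by (simp add: colouring4_def)

lemma nat_less4_cases:
  fixes n :: nat
  assumes "n < 4"
  obtains "n = 0" | "n = 1" | "n = 2" | "n = 3"
  using assms by linarith

lemma separate_vertices:
  fixes i j :: nat
  assumes "i \<noteq> j"
  shows "\<exists>f. separating f \<and> f i \<noteq> f j"
  using assms
proof (induction i j rule: linorder_wlog)
  case (le i j)
  \<comment> \<open>Among the vertices below 4, the first colouring identifies only 0 and 2, the
    second only 1 and 3; so one of them tells any two apart.\<close>
  have s1: "separating (colouring4 0 1 0 2)" and s2: "separating (colouring4 0 1 2 1)"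
    by (rule separating_colouring4; simp add: doubleton_eq_iff)+
  show ?case
  proof (cases "j < 4")
    case True
    then have "i < 4"
      using le by simp
    have "colouring4 0 1 0 2 i \<noteq> colouring4 0 1 0 2 j \<or> colouring4 0 1 2 1 i \<noteq> colouring4 0 1 2 1 j"
      using le \<open>i < 4\<close> True by (elim nat_less4_cases) auto
    then show ?thesis
      using s1 s2 by blast
  next
    case False
    let ?f = "colouring4 0 1 0 2"
    \<comment> \<open>A vertex from 4 on may be recoloured freely, and one of the colours 0 and 1
      differs from that of \<open>i\<close>.\<close>
    let ?c = "if ?f i = 0 then 1 else 0"
    have "separating (?f(j := ?c))"
      using False s1 by (intro separating_upd) auto
    moreover have "(?f(j := ?c)) i \<noteq> (?f(j := ?c)) j"
      using le by simp
    ultimately show ?thesis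
      by blast
  qed
next
  case (sym i j)
  then show ?case
    by metis
qed

lemma separating_range: "separating f \<Longrightarrow> f n \<in> {0, 1, 2}"
  by (simp add: separating_def)

text \<open>If \<open>p\<close> is \<open>a\<close> or \<open>b\<close>, the third colour works;
  otherwise \<open>p\<close> itself distinguishes the two pairs and \<open>c = a\<close>
  works.\<close>

lemma other_colour:
  fixes a b p :: nat
  assumes "a \<in> {0, 1, 2}" "b \<in> {0, 1, 2}" "p \<in> {0, 1, 2}" "a \<noteq> b"
  obtains c where "c \<in> {0, 1, 2}" "p \<noteq> c" "{a, b} \<noteq> {p, c}"
proof (cases "p \<in> {a, b}")
  case True
  have "\<not> {0, 1, 2} \<subseteq> {a, b}"
    by auto
  then obtain c where c: "c \<in> {0, 1, 2}" "c \<notin> {a, b}"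
    by blast
  then have "{a, b} \<noteq> {p, c}" "p \<noteq> c"
    using True by blast+
  with c(1) show ?thesis
    by (intro that)
next
  case False
  then have "{a, b} \<noteq> {p, a}" "p \<noteq> a"
    by blast+
  with assms(1) show ?thesis
    by (intro that)
qed

text \<open>View the colours as vertices of a triangle: two distinct edges share exactly one vertex
  and together cover all three.\<close>

lemma distinct_colour_pairs:
  fixes a b p q :: nat
  assumes "a \<in> {0, 1, 2}" "b \<in> {0, 1, 2}" "p \<in> {0, 1, 2}" "q \<in> {0, 1, 2}"
    and "a \<noteq> b" "p \<noteq> q" "{a, b} \<noteq> {p, q}"
  shows "p \<in> {a, b} \<longleftrightarrow> q \<notin> {a, b}" and "{a, b, p, q} = {0, 1, 2}"
proof -
  have "(p \<in> {a, b} \<longleftrightarrow> q \<notin> {a, b}) \<and> {0, 1, 2} \<subseteq> {a, b, p, q}"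
    using assms by (elim insertE emptyE) (simp_all add: doubleton_eq_iff)
  then show "p \<in> {a, b} \<longleftrightarrow> q \<notin> {a, b}" and "{a, b, p, q} = {0, 1, 2}"
    using assms by blast+
qed

text \<open>A vertex outside the two red edges can be coloured last.\<close>

lemma separate_new_vertex:
  assumes "separating f" "f i \<noteq> f j" "4 \<le> q" "q \<notin> {i, j, p}"
  shows "\<exists>f. separating f \<and> f i \<noteq> f j \<and> f p \<noteq> f q \<and> {f i, f j} \<noteq> {f p, f q}"
proof -
  note range = separating_range[OF assms(1)]
  obtain c where c: "c \<in> {0, 1, 2}" "f p \<noteq> c" "{f i, f j} \<noteq> {f p, c}"
    using other_colour[OF range range range assms(2)] by blast
  define g where "g = f(q := c)"
  have "separating g"
    unfolding g_def using assms(1,3) c(1) by (rule separating_upd)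
  moreover have "g i = f i" "g j = f j" "g p = f p" "g q = c"
    using assms(4) by (auto simp: g_def)
  ultimately show ?thesis
    using assms(2) c by (intro exI[of _ g]) simp
qed

text \<open>The cases depend on the largest end of the two edges. If it is at least 4, it is
  coloured last; otherwise both edges lie in the 4-cycle 0, 2, 1, 3 that the red edges leave on the
  first four vertices.\<close>

lemma separate_edges:
  fixes i j p q :: nat
  assumes "i < j" "p < q" "(i, j) \<noteq> (p, q)"
    and blue: "(i, j) \<notin> {(0, 1), (2, 3)}" "(p, q) \<notin> {(0, 1), (2, 3)}"
  shows "\<exists>f. separating f \<and> f i \<noteq> f j \<and> f p \<noteq> f q \<and> {f i, f j} \<noteq> {f p, f q}"
proof -
  consider (eq) "j = q" "4 \<le> q" | (less) "j < q" "4 \<le> q" | (gr) "q < j" "4 \<le> j" | (small) "j < 4" "q < 4"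
    by linarith
  then show ?thesis
  proof cases
    case eq
    then have "i \<noteq> p"
      using assms by auto
    then obtain f where f: "separating f" "f i \<noteq> f p"
      using separate_vertices by blast
    \<comment> \<open>The common end gets a colour different from those of both other ends, which
      differ from each other.\<close>
    have "\<not> {0, 1, 2} \<subseteq> {f i, f p}"
      by auto
    then obtain c where c: "c \<in> {0, 1, 2}" "c \<notin> {f i, f p}"
      by blast
    define g where "g = f(q := c)"
    have "separating g"
      unfolding g_def using f(1) eq(2) c(1) by (rule separating_upd)
    moreover have "g i = f i" "g j = c" "g p = f p" "g q = c"
      using assms(1,2) eq(1) by (auto simp: g_def)
    ultimately show ?thesis
      using c(2) f(2) by (intro exI[of _ g]) (simp add: doubleton_eq_iff)
  next
    case less
    then show ?thesis
      using separate_vertices[of i j] separate_new_vertex[of _ i j q p] assms(1,2) by auto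
  next
    case gr
    then have "\<exists>f. separating f \<and> f p \<noteq> f q \<and> f i \<noteq> f j \<and> {f p, f q} \<noteq> {f i, f j}"
      using separate_vertices[of p q] separate_new_vertex[of _ p q j i] assms(1,2) by auto
    then show ?thesis
      by metis
  next
    case small
    \<comment> \<open>Each of these makes exactly one of the edges 02, 03, 12, 13 monochromatic and
      gives the other three distinct colour pairs. For two given edges, pick one that makes a third
      edge monochromatic.\<close>
    have sep: "separating (colouring4 0 1 0 2)" "separating (colouring4 0 1 2 0)"
      "separating (colouring4 0 1 1 2)" "separating (colouring4 0 1 2 1)"
      by (rule separating_colouring4; simp add: doubleton_eq_iff)+
    have inner: "(a, b) \<in> {(0, 2), (0, 3), (1, 2), (1, 3)}"
      if "a < b" "b < 4" "(a, b) \<notin> {(0, 1), (2, 3)}" for a b :: nat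
      using that by (auto simp: numeral_eq_Suc less_Suc_eq)
    have "(i, j) \<in> {(0, 2), (0, 3), (1, 2), (1, 3)}" "(p, q) \<in> {(0, 2), (0, 3), (1, 2), (1, 3)}"
      using inner[of i j] inner[of p q] small assms by simp_all
    then have "\<exists>f\<in>{colouring4 0 1 0 2, colouring4 0 1 2 0, colouring4 0 1 1 2, colouring4 0 1 2 1}.
      f i \<noteq> f j \<and> f p \<noteq> f q \<and> {f i, f j} \<noteq> {f p, f q}"
      using assms(3) by (elim insertE emptyE) (simp_all add: doubleton_eq_iff)
    then show ?thesis
      using sep by blast
  qed
qed

section \<open>A clique with an extra point\<close>

definition unit_vec :: "nat \<Rightarrow> nat \<Rightarrow> real" where
  "unit_vec i n = of_bool (n = i)"

text \<open>Points are coded as naturals because \<open>blue_count\<close> ranges over ground sets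
  of naturals.\<close>

definition edge :: "nat \<Rightarrow> nat \<Rightarrow> nat" where
  "edge i j = prod_encode (i, j)"

text \<open>The degenerate code \<open>edge 0 0\<close> stands for the extra red point.\<close>

definition vec :: "nat \<Rightarrow> nat \<Rightarrow> real" where
  "vec x = (case prod_decode x of (i, j) \<Rightarrow>
    if i = j then (unit_vec 0 - unit_vec 2) + (unit_vec 1 - unit_vec 3) else unit_vec i - unit_vec j)"

definition ground :: "nat \<Rightarrow> nat set" where
  "ground k = insert (edge 0 0) {edge i j | i j. i < j \<and> j \<le> k + 1}"

definition red :: "nat set" where
  "red = {edge 0 0, edge 0 1, edge 2 3}"

lemma edge_eq_iff [simp]: "edge i j = edge p q \<longleftrightarrow> i = p \<and> j = q"
  by (simp add: edge_def)

lemma edge_in_ground: "i < j \<Longrightarrow> edge i j \<in> ground k \<longleftrightarrow> j \<le> k + 1"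
  by (auto simp: ground_def)

lemma extra_in_ground: "edge 0 0 \<in> ground k"
  by (simp add: ground_def)

lemma ground_cases:
  assumes "x \<in> ground k"
  obtains "x = edge 0 0" | i j where "x = edge i j" "i < j" "j \<le> k + 1"
  using assms by (auto simp: ground_def)

lemma vec_edge: "i \<noteq> j \<Longrightarrow> vec (edge i j) = unit_vec i - unit_vec j"
  by (simp add: vec_def edge_def)

lemma vec_extra: "vec (edge 0 0) = (unit_vec 0 - unit_vec 2) + (unit_vec 1 - unit_vec 3)"
  by (simp add: vec_def edge_def)

lemma sum_unit_vec: "finite A \<Longrightarrow> sum (unit_vec i) A = of_bool (i \<in> A)"
  unfolding unit_vec_def of_bool_def by simp

lemma sum_vec_edge:
  "finite A \<Longrightarrow> i \<noteq> j \<Longrightarrow> sum (vec (edge i j)) A = of_bool (i \<in> A) - of_bool (j \<in> A)"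
  by (simp add: vec_edge fun_diff_def sum_subtractf sum_unit_vec)

lemma sum_vec_extra:
  "finite A \<Longrightarrow> sum (vec (edge 0 0)) A =
    of_bool (0 \<in> A) + of_bool (1 \<in> A) - of_bool (2 \<in> A) - of_bool (3 \<in> A)"
  by (simp add: vec_extra fun_diff_def plus_fun_def sum_subtractf sum.distrib sum_unit_vec)

lemma vec_notin_span:
  assumes "sum (vec x) A \<noteq> 0" "\<And>y. y \<in> X \<Longrightarrow> sum (vec y) A = 0"
  shows "vec x \<notin> fn.span (vec ` X)"
  using sum_eq_0_on_span[of "vec x" "vec ` X" A] assms by auto

text \<open>Connectivity expressed through spans instead of paths, so that the extra vector is taken
  into account as well.\<close>

definition linked :: "nat set \<Rightarrow> nat \<Rightarrow> nat \<Rightarrow> bool" where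
  "linked X a b \<longleftrightarrow> unit_vec a - unit_vec b \<in> fn.span (vec ` X)"

lemma linked_refl: "linked X a a"
  by (simp add: linked_def fn.span_zero)

lemma linked_sym: "linked X a b \<Longrightarrow> linked X b a"
  using fn.span_neg[of "unit_vec a - unit_vec b" "vec ` X"] by (simp add: linked_def)

lemma linked_trans: "linked X a b \<Longrightarrow> linked X b c \<Longrightarrow> linked X a c"
  using fn.span_add[of "unit_vec a - unit_vec b" "vec ` X" "unit_vec b - unit_vec c"]
  by (simp add: linked_def)

lemma linked_edge: "edge a b \<in> X \<Longrightarrow> a \<noteq> b \<Longrightarrow> linked X a b"
  by (metis fn.span_base imageI linked_def vec_edge)

lemma finite_ground_pairs: "finite {(i, j). i < j \<and> j < (n::nat)}"
  by (rule finite_subset[of _ "{..<n} \<times> {..<n}"]) auto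

lemma card_ground_pairs: "card {(i, j). i < j \<and> j < (n::nat)} = n choose 2"
proof (induction n)
  case (Suc n)
  have "{(i, j). i < j \<and> j < Suc n} = {(i, j). i < j \<and> j < n} \<union> (\<lambda>i. (i, n)) ` {..<n}"
    by auto
  also have "card \<dots> = (n choose 2) + n"
    by (subst card_Un_disjoint) (auto simp: finite_ground_pairs Suc card_image inj_on_def)
  finally show ?case
    by (simp add: numeral_2_eq_2)
qed simp

lemma ground_eq: "ground k = insert (edge 0 0) ((\<lambda>(i, j). edge i j) ` {(i, j). i < j \<and> j < k + 2})"
  by (auto simp: ground_def)

lemma finite_ground: "finite (ground k)"
  by (simp add: ground_eq finite_ground_pairs)

lemma card_ground: "card (ground k) = ((k + 2) choose 2) + 1"
proof -
  have "inj_on (\<lambda>(i, j). edge i j) S" for S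
    by (auto simp: inj_on_def)
  then have "card ((\<lambda>(i, j). edge i j) ` {(i, j). i < j \<and> j < k + 2}) = (k + 2) choose 2"
    using card_ground_pairs[of "k + 2"] by (simp add: card_image)
  moreover have "edge 0 0 \<notin> (\<lambda>(i, j). edge i j) ` {(i, j). i < j \<and> j < k + 2}"
    by auto
  ultimately show ?thesis
    unfolding ground_eq by (simp add: finite_ground_pairs del: add_2_eq_Suc')
qed

text \<open>Serves to show that no two points are parallel.\<close>

lemma ground_separating_functional:
  assumes "x \<in> ground k" "y \<in> ground k" "x \<noteq> y"
  obtains A where "finite A" "sum (vec x) A \<noteq> 0" "sum (vec y) A = 0"
proof (cases rule: ground_cases[OF assms(1)])
  case 1
  with assms obtain p q where y: "y = edge p q" "p < q"
    by (auto elim: ground_cases)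
  \<comment> \<open>The extra vector is nonzero at 0, 1 and 2, and an edge has only two
    ends.\<close>
  obtain c where c: "c \<in> {0, 1, 2}" "c \<noteq> p" "c \<noteq> q"
    using y by (metis insertCI zero_neq_one zero_neq_numeral one_eq_numeral_iff num.distinct(1))
  have "sum (vec x) {c} \<noteq> 0"
    unfolding 1 using c(1) by (subst sum_vec_extra) auto
  moreover have "sum (vec y) {c} = 0"
    unfolding y(1) using c y(2) by (subst sum_vec_edge) auto
  ultimately show ?thesis
    using that[of "{c}"] by simp
next
  case (2 i j)
  show ?thesis
  proof (cases rule: ground_cases[OF assms(2)])
    case 1
    have "\<exists>A. finite A \<and> sum (vec x) A \<noteq> 0 \<and> sum (vec y) A = 0"
    proof (cases "j < 4")
      case False
      \<comment> \<open>The extra vector is supported on the vertices below 4.\<close>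
      then have "sum (vec x) {j} \<noteq> 0" "sum (vec y) {j} = 0"
        unfolding 1 2 using \<open>i < j\<close> by (simp_all add: vec_edge vec_extra unit_vec_def)
      then show ?thesis
        by (intro exI[of _ "{j}"]) simp
    next
      case True
      \<comment> \<open>One vertex is taken from 0, 1 and one from 2, 3, so the extra vector sums to
        0; exactly one end of the edge \<open>x\<close> is among them.\<close>
      let ?A = "if (i, j) = (0, 2) then {0, 3} else if i = 1 then {1, if j = 2 then 3 else 2} else {0, 2}"
      have "(i, j) \<in> {(0, 1), (0, 2), (0, 3), (1, 2), (1, 3), (2, 3)}"
        using True \<open>i < j\<close> by (auto simp: numeral_eq_Suc less_Suc_eq)
      then have "sum (vec x) ?A \<noteq> 0 \<and> sum (vec y) ?A = 0"
        unfolding 1 2 by (elim insertE emptyE) (simp_all add: vec_edge vec_extra unit_vec_def)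
      then show ?thesis
        by (intro exI[of _ ?A]) simp
    qed
    then show ?thesis
      using that by blast
  next
    case (2 p q)
    have "\<not> (i \<in> {p, q} \<and> j \<in> {p, q})"
      using assms(3) \<open>i < j\<close> \<open>x = edge i j\<close> 2 by auto
    then obtain c where c: "c \<in> {i, j}" "c \<notin> {p, q}"
      by blast
    have "sum (vec x) {c} \<noteq> 0"
      unfolding \<open>x = edge i j\<close> using c(1) \<open>i < j\<close> by (auto simp: vec_edge unit_vec_def)
    moreover have "sum (vec y) {c} = 0"
      unfolding \<open>y = edge p q\<close> using c(2) \<open>p < q\<close> by (simp add: vec_edge unit_vec_def)
    ultimately show ?thesis
      using that[of "{c}"] by simp
  qed
qed

section \<open>Rank, simplicity and representability of the example\<close>

text \<open>The vertices are \<open>0, ..., k + 1\<close>, so the assumption provides vertices 2 and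
  3.\<close>

locale augmented_clique =
  fixes k :: nat
  assumes k_ge_2: "k \<ge> 2"
begin

sublocale M: column_matroid "\<lambda>(c::real) (f :: nat \<Rightarrow> real) n. c * f n" "ground k" vec
  by unfold_locales (rule finite_ground)

lemma rank_spanning:
  assumes "X \<subseteq> ground k"
    and linked: "\<And>a b. a \<le> k + 1 \<Longrightarrow> b \<le> k + 1 \<Longrightarrow> linked X a b"
  shows "M.rank X = M.rank (ground k)"
proof -
  have "vec y \<in> fn.span (vec ` X)" if "y \<in> ground k" for y
  proof (cases rule: ground_cases[OF that])
    case 1
    have "vec y = (unit_vec 0 - unit_vec 2) + (unit_vec 1 - unit_vec 3)"
      by (simp add: 1 vec_extra)
    then show ?thesis
      using linked[of 0 2] linked[of 1 3] k_ge_2 by (simp add: linked_def fn.span_add)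
  next
    case (2 i j)
    then show ?thesis
      using linked[of i j] by (simp add: linked_def vec_edge)
  qed
  then have "M.rank (X \<union> ground k) = M.rank X"
    using M.rank_insert_columns[OF assms(1)] by (intro M.rank_union_eq) simp
  then show ?thesis
    using assms(1) by (simp add: Un_absorb1)
qed

text \<open>Coordinate \<open>Suc m\<close> vanishes on the shorter star, so each further edge
  raises the rank by one.\<close>

lemma rank_star: "m \<le> k + 1 \<Longrightarrow> M.rank (edge 0 ` {1..m}) = m"
proof (induction m)
  case 0
  then show ?case
    using M.rank_indep[OF M.indep_empty] by simp
next
  case (Suc m)
  have "vec (edge 0 (Suc m)) \<notin> fn.span (vec ` edge 0 ` {1..m})"
    by (rule vec_notin_span[where A = "{Suc m}"]) (auto simp: vec_edge unit_vec_def)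
  moreover have "edge 0 ` {1..m} \<subseteq> ground k" "edge 0 (Suc m) \<in> ground k"
    using Suc(2) by (auto simp: edge_in_ground)
  moreover have "edge 0 ` {1..Suc m} = insert (edge 0 (Suc m)) (edge 0 ` {1..m})"
    by (simp add: atLeastAtMostSuc_conv)
  ultimately show ?case
    using Suc M.rank_insert_columns by simp
qed

lemma rank_ground: "M.rank (ground k) = k + 1"
proof -
  \<comment> \<open>The star at 0 is a spanning tree.\<close>
  let ?X = "edge 0 ` {1..k + 1}"
  have star: "linked ?X 0 a" if "a \<le> k + 1" for a
    using that by (cases "a = 0") (auto intro: linked_refl linked_edge)
  have "M.rank ?X = M.rank (ground k)"
  proof (rule rank_spanning)
    show "linked ?X a b" if "a \<le> k + 1" "b \<le> k + 1" for a b
      using linked_sym[OF star[OF that(1)]] star[OF that(2)] by (rule linked_trans)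
  qed (auto simp: edge_in_ground)
  then show ?thesis
    using rank_star[of "k + 1"] by simp
qed

lemma simple_ground: M.simple
  unfolding M.simple_def
proof (intro ballI)
  have single: "M.column_indep {x}" if x: "x \<in> ground k" for x
  proof -
    obtain y where "y \<in> ground k" "x \<noteq> y"
      using extra_in_ground[of k] edge_in_ground[of 0 1 k] by (metis edge_eq_iff less_one le_add2 zero_neq_one)
    then obtain A where "sum (vec x) A \<noteq> 0"
      using ground_separating_functional x by metis
    then have "vec x \<notin> fn.span (vec ` {})"
      by (rule vec_notin_span) simp
    then show ?thesis
      using x M.column_indep_insert[of x "{}"] M.indep_empty by simp
  qed
  fix x y
  assume xy: "x \<in> ground k" "y \<in> ground k"
  show "M.column_indep {x, y}"
  proof (cases "x = y")
    case False
    obtain A where "sum (vec x) A \<noteq> 0" "sum (vec y) A = 0"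
      using ground_separating_functional xy False by metis
    then have "vec x \<notin> fn.span (vec ` {y})"
      by (intro vec_notin_span[where A = A]) auto
    then show ?thesis
      using xy False single M.column_indep_insert[of x "{y}"] by simp
  qed (use single xy in simp)
qed

lemma representable: M.real_representable
proof (rule real_representable_columns[OF finite_ground])
  fix x n
  assume "x \<in> ground k" "n \<ge> k + 2"
  then show "vec x n = 0"
    using k_ge_2 by (elim ground_cases) (auto simp: vec_edge vec_extra unit_vec_def)
qed

lemma flat_contains_spanned:
  assumes "M.flat F" "x \<in> ground k" "vec x \<in> fn.span (vec ` F)"
  shows "x \<in> F"
  using assms M.rank_insert_columns[of F x] unfolding M.flat_def by force

section \<open>Red points on hyperplanes\<close>

lemma hyperplane_meets_red: "M.C2 red"
  unfolding M.C2_def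
proof (intro allI impI notI)
  fix H
  assume "M.hyperplane H" and disj: "H \<inter> red = {}"
  then have H: "M.flat H" "H \<subseteq> ground k" "M.rank H = k"
    using rank_ground by (auto simp: M.hyperplane_def M.flat_def)
  have notin: "vec x \<notin> fn.span (vec ` H)" if "x \<in> ground k" "x \<in> red" for x
    using flat_contains_spanned[OF H(1) that(1)] that(2) disj by auto
  have red: "\<not> linked H 0 1" "\<not> linked H 2 3"
    "(unit_vec 0 - unit_vec 2) + (unit_vec 1 - unit_vec 3) \<notin> fn.span (vec ` H)"
    using notin[of "edge 0 1"] notin[of "edge 2 3"] notin[of "edge 0 0"] k_ge_2
    by (simp_all add: red_def linked_def edge_in_ground extra_in_ground vec_edge vec_extra)
  \<comment> \<open>Edges in \<open>H\<close> stay inside a class, and the extra point, being red,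
    is not in \<open>H\<close>. Hence the sum over a class is a functional vanishing on
    \<open>H\<close>.\<close>
  define cls where "cls p = {a. a \<le> k + 1 \<and> linked H p a}" for p
  have fin: "finite (cls p)" for p
    unfolding cls_def by (rule finite_subset[of _ "{..k + 1}"]) auto
  have self: "p \<in> cls p" if "p \<le> k + 1" for p
    using that by (simp add: cls_def linked_refl)
  have H0: "sum (vec x) (cls p) = 0" if x: "x \<in> H" for x p
  proof (cases rule: ground_cases[OF subsetD[OF H(2) x]])
    case 1
    then show ?thesis
      using x disj by (auto simp: red_def)
  next
    case (2 i j)
    have "linked H i j"
      using x 2 by (auto intro: linked_edge)
    then have "linked H p i \<longleftrightarrow> linked H p j"
      using linked_trans linked_sym by blast
    then have "i \<in> cls p \<longleftrightarrow> j \<in> cls p"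
      using 2 by (simp add: cls_def)
    then show ?thesis
      using 2 by (simp add: sum_vec_edge fin)
  qed
  \<comment> \<open>Otherwise 0, 1 and c lie in three different classes, and adding the edges 01 and 0c to H
    raises the rank by 2.\<close>
  have two_classes: "linked H 0 c \<or> linked H 1 c"
    if c: "c \<in> {2, 3}" for c
  proof (rule ccontr)
    assume contr: "\<not> ?thesis"
    let ?x = "edge 0 1" and ?y = "edge 0 c"
    have c': "0 < c" "c \<le> k + 1" "c \<noteq> 1"
      using c k_ge_2 by auto
    have ground: "?x \<in> ground k" "?y \<in> ground k"
      using c' by (simp_all add: edge_in_ground)
    have out: "0 \<notin> cls c" "1 \<notin> cls c"
      using contr linked_sym by (auto simp: cls_def)
    have "vec ?y \<notin> fn.span (vec ` insert ?x H)"
      by (rule vec_notin_span[where A = "cls c"])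
        (use out c' self[of c] H0 in \<open>auto simp: sum_vec_edge fin\<close>)
    then have "M.rank (insert ?y (insert ?x H)) = M.rank (insert ?x H) + 1"
      using M.rank_insert_columns[of "insert ?x H" ?y] ground H(2) by simp
    moreover have "M.rank (insert ?x H) = M.rank H + 1"
      using M.rank_insert_columns[of H ?x] ground H(2) red(1) by (simp add: linked_def vec_edge)
    moreover have "M.rank (insert ?y (insert ?x H)) \<le> k + 1"
      using M.rank_mono[of "insert ?y (insert ?x H)" "ground k"] ground H(2) rank_ground by simp
    ultimately show False
      using H(3) by simp
  qed
  \<comment> \<open>Each of 2 and 3 is linked to 0 or 1, and not both to the same vertex. This
    leaves two pairings, and either puts the extra vector into the span.\<close>
  have "\<not> (linked H 0 2 \<and> linked H 1 3)"
    using red(3) fn.span_add unfolding linked_def by blast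
  moreover have "\<not> (linked H 0 3 \<and> linked H 1 2)"
  proof -
    have "(unit_vec 0 - unit_vec 2) + (unit_vec 1 - unit_vec 3) =
        (unit_vec 0 - unit_vec 3) + (unit_vec 1 - unit_vec 2)"
      by (simp add: fun_eq_iff)
    then show ?thesis
      using red(3) fn.span_add unfolding linked_def by metis
  qed
  moreover have "\<not> (linked H a 2 \<and> linked H a 3)" for a
    using red(2) linked_trans linked_sym by blast
  ultimately show False
    using two_classes[of 2] two_classes[of 3] by blast
qed

section \<open>Flats of colour classes and blue lines\<close>

definition monochromatic :: "(nat \<Rightarrow> nat) \<Rightarrow> nat set" where
  "monochromatic f = {edge i j | i j. i < j \<and> j \<le> k + 1 \<and> f i = f j}"

lemma monochromatic_subset: "monochromatic f \<subseteq> ground k"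
  by (auto simp: monochromatic_def ground_def)

lemma sum_vec_colours:
  assumes "i < j" "j \<le> k + 1"
  shows "sum (vec (edge i j)) {n. n \<le> k + 1 \<and> f n \<in> C} = of_bool (f i \<in> C) - of_bool (f j \<in> C)"
  using assms by (simp add: sum_vec_edge)

lemma sum_vec_monochromatic:
  assumes "x \<in> monochromatic f"
  shows "sum (vec x) {n. n \<le> k + 1 \<and> f n \<in> C} = 0"
proof -
  obtain i j where x: "x = edge i j" "i < j" "j \<le> k + 1" "f i = f j"
    using assms by (auto simp: monochromatic_def)
  show ?thesis
    unfolding x(1) sum_vec_colours[OF x(2,3)] by (simp add: x(4))
qed

text \<open>Sums over colour classes vanish on monochromatic edges. A bichromatic edge is detected
  by the class of an end, the extra point by a colour occurring on 0, 1 but not on 2, 3.\<close>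

lemma flat_monochromatic:
  assumes f: "separating f"
  shows "M.flat (monochromatic f)"
  unfolding M.flat_def
proof (intro conjI ballI)
  fix x
  assume x: "x \<in> ground k - monochromatic f"
  then have "x \<in> ground k"
    by simp
  have "\<exists>C. sum (vec x) {n. n \<le> k + 1 \<and> f n \<in> C} \<noteq> 0"
  proof (cases rule: ground_cases[OF \<open>x \<in> ground k\<close>])
    case 1
    have "f 0 \<noteq> f 1" "{f 0, f 1} \<noteq> {f 2, f 3}"
      using f by (simp_all add: separating_def)
    then have "\<not> {f 0, f 1} \<subseteq> {f 2, f 3}"
      by auto
    then obtain s where "s \<in> {f 0, f 1}" "s \<notin> {f 2, f 3}"
      by blast
    then have "sum (vec x) {n. n \<le> k + 1 \<and> f n \<in> {s}} \<noteq> 0"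
      unfolding 1 using k_ge_2 by (subst sum_vec_extra) auto
    then show ?thesis
      by blast
  next
    case (2 i j)
    then have "f i \<noteq> f j"
      using x by (auto simp: monochromatic_def)
    then have "sum (vec x) {n. n \<le> k + 1 \<and> f n \<in> {f i}} \<noteq> 0"
      using 2 by (simp only: sum_vec_colours) simp
    then show ?thesis
      by blast
  qed
  then have "vec x \<notin> fn.span (vec ` monochromatic f)"
    using vec_notin_span sum_vec_monochromatic by blast
  then show "M.rank (monochromatic f) < M.rank (insert x (monochromatic f))"
    using M.rank_insert_columns[OF monochromatic_subset] x by simp
qed (rule monochromatic_subset)

lemma monochromatic_disjoint_red:
  assumes "separating f"
  shows "monochromatic f \<inter> red = {}"
  using assms by (auto simp: monochromatic_def red_def separating_def)

text \<open>Adding the two edges raises the rank by one each time and yields a spanning set, so the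
  rank of the flat follows without counting components.\<close>

lemma monochromatic_complement:
  assumes f: "separating f"
    and x: "i < j" "j \<le> k + 1" and y: "p < q" "q \<le> k + 1"
    and sep: "f i \<noteq> f j" "f p \<noteq> f q" "{f i, f j} \<noteq> {f p, f q}"
  shows "M.rank (monochromatic f) = k - 1"
    and "M.rank (insert (edge p q) (insert (edge i j) (monochromatic f))) = k + 1"
proof -
  let ?F = "monochromatic f" and ?x = "edge i j" and ?y = "edge p q"
  have ground: "?x \<in> ground k" "?y \<in> ground k" "?F \<subseteq> ground k"
    using x y monochromatic_subset by (auto simp: edge_in_ground)
  note range = separating_range[OF f]
  note meet = distinct_colour_pairs(1)[OF range range range range sep]
    and cover = distinct_colour_pairs(2)[OF range range range range sep]
  have "vec ?x \<notin> fn.span (vec ` ?F)"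
    by (rule vec_notin_span[where A = "{n. n \<le> k + 1 \<and> f n \<in> {f i}}"])
      (use sep(1) in \<open>simp_all only: sum_vec_colours[OF x] sum_vec_monochromatic, simp\<close>)
  then have 1: "M.rank (insert ?x ?F) = M.rank ?F + 1"
    using M.rank_insert_columns[of ?F ?x] ground by simp
  \<comment> \<open>Both ends of the first edge have colours in \<open>{f i, f j}\<close>, but
    exactly one end of the second does.\<close>
  have "vec ?y \<notin> fn.span (vec ` insert ?x ?F)"
  proof (rule vec_notin_span[where A = "{n. n \<le> k + 1 \<and> f n \<in> {f i, f j}}"])
    show "sum (vec ?y) {n. n \<le> k + 1 \<and> f n \<in> {f i, f j}} \<noteq> 0"
      unfolding sum_vec_colours[OF y] using meet by simp
    show "sum (vec z) {n. n \<le> k + 1 \<and> f n \<in> {f i, f j}} = 0" if "z \<in> insert ?x ?F" for z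
    proof (cases "z = ?x")
      case True
      then show ?thesis
        by (simp only: sum_vec_colours[OF x]) simp
    qed (use that sum_vec_monochromatic in blast)
  qed
  then have 2: "M.rank (insert ?y (insert ?x ?F)) = M.rank (insert ?x ?F) + 1"
    using M.rank_insert_columns[of "insert ?x ?F" ?y] ground by simp
  let ?S = "insert ?y (insert ?x ?F)"
  have same: "linked ?S a b" if "f a = f b" "a \<le> k + 1" "b \<le> k + 1" for a b
    using that
  proof (induction a b rule: linorder_wlog)
    case (le a b)
    show ?case
    proof (cases "a = b")
      case True
      then show ?thesis
        by (simp add: linked_refl)
    next
      case False
      then have "edge a b \<in> ?F"
        using le by (auto simp: monochromatic_def)
      then show ?thesis
        using False by (simp add: linked_edge)
    qed
  qed (simp add: linked_sym)
  have ij: "linked ?S i j" and pq: "linked ?S p q"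
    using x y by (simp_all add: linked_edge)
  \<comment> \<open>Two distinct edges of a triangle form a spanning tree.\<close>
  have to_i: "linked ?S a i" if a: "a \<le> k + 1" for a
  proof -
    have le: "i \<le> k + 1" "j \<le> k + 1" "p \<le> k + 1" "q \<le> k + 1"
      using x y by auto
    have "f i = f p \<or> f i = f q \<or> f j = f p \<or> f j = f q"
      using meet by auto
    then have "linked ?S p i \<and> linked ?S q i"
      using same le linked_trans linked_sym ij pq by meson
    moreover have "f a = f i \<or> f a = f j \<or> f a = f p \<or> f a = f q"
      using range[of a] unfolding cover[symmetric] by simp
    ultimately show ?thesis
      using same[of a] le a linked_trans linked_sym[OF ij] by meson
  qed
  have "M.rank (insert ?y (insert ?x ?F)) = M.rank (ground k)"
  proof (rule rank_spanning)
    show "linked ?S a b" if "a \<le> k + 1" "b \<le> k + 1" for a b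
      using to_i[OF that(1)] linked_sym[OF to_i[OF that(2)]] by (rule linked_trans)
  qed (use ground in auto)
  then show "M.rank (insert ?y (insert ?x ?F)) = k + 1"
    by (simp add: rank_ground)
  with 1 2 show "M.rank ?F = k - 1"
    by simp
qed

lemma blue_lines_have_skew_flat: "M.C3 k red (ground k - red)"
  unfolding M.C3_def
proof (intro allI impI)
  let ?B = "ground k - red"
  fix L
  assume L: "matroid.line ?B (M.restrict_indep ?B) L"
  have sub: "?B \<subseteq> ground k"
    by auto
  interpret B: matroid ?B "M.restrict_indep ?B"
    using sub by (rule M.matroid_restrict)
  have LB: "L \<subseteq> ?B" and "B.rank L = 2"
    using L by (auto simp: B.line_def B.flat_def)
  then have rankL: "M.rank L = 2"
    using M.restrict_rank[OF sub] by simp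
  obtain I where I: "I \<subseteq> L" "card I = 2"
    using M.basis_exists[of L] rankL by metis
  then obtain x y where xy: "x \<noteq> y" "x \<in> L" "y \<in> L"
    by (auto simp: card_2_iff)
  have blue: "\<exists>i j. z = edge i j \<and> i < j \<and> j \<le> k + 1 \<and> (i, j) \<notin> {(0, 1), (2, 3)}" if "z \<in> L" for z
    using that LB by (auto simp: ground_def red_def)
  obtain i j where x: "x = edge i j" "i < j" "j \<le> k + 1" "(i, j) \<notin> {(0, 1), (2, 3)}"
    using blue xy(2) by blast
  obtain p q where y: "y = edge p q" "p < q" "q \<le> k + 1" "(p, q) \<notin> {(0, 1), (2, 3)}"
    using blue xy(3) by blast
  obtain f where f: "separating f" "f i \<noteq> f j" "f p \<noteq> f q" "{f i, f j} \<noteq> {f p, f q}"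
    using separate_edges[OF x(2) y(2) _ x(4) y(4)] xy(1) x(1) y(1) by auto
  let ?F = "monochromatic f"
  note ranks = monochromatic_complement[OF f(1) x(2,3) y(2,3) f(2-4)]
  \<comment> \<open>The flat together with \<open>x\<close> and \<open>y\<close> already has rank
    \<open>k + 1 = (k - 1) + 2\<close>, so its union with \<open>L\<close> has this rank
    too.\<close>
  have "M.rank (insert y (insert x ?F)) \<le> M.rank (?F \<union> L)"
    using xy by (intro M.rank_mono) auto
  moreover have "M.rank (?F \<union> L) \<le> k + 1"
    using M.rank_mono[of "?F \<union> L" "ground k"] monochromatic_subset LB rank_ground by auto
  ultimately have "M.skew ?F L"
    using ranks rankL k_ge_2 x(1) y(1) by (simp add: M.skew_def)
  then show "\<exists>F. M.flat F \<and> M.rank F = k - 1 \<and> M.skew F L \<and> F \<inter> red = {}"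
    using flat_monochromatic monochromatic_disjoint_red f(1) ranks(1) by blast
qed

section \<open>Number of blue points and conclusion\<close>

lemma red_subset: "red \<subseteq> ground k"
  using k_ge_2 by (auto simp: red_def edge_in_ground extra_in_ground)

lemma card_red: "card red = 3"
  by (simp add: red_def)

lemma rank_blue: "M.C1 (ground k - red)"
proof -
  let ?X = "{edge 0 2, edge 0 3}"
  have X: "?X \<subseteq> ground k - red"
    using k_ge_2 by (auto simp: red_def edge_in_ground)
  then have "M.column_indep ?X"
    using simple_ground unfolding M.simple_def by blast
  then have "card ?X \<le> M.rank (ground k - red)"
    using X by (rule M.card_le_rank)
  then show ?thesis
    by (simp add: M.C1_def)
qed

lemma blue_count_example: "blue_count k 3 (((k + 2) choose 2) - 2)"
  unfolding blue_count_def
proof (intro exI conjI)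
  show "matroid (ground k) M.column_indep"
    by (rule M.matroid_axioms)
  show "M.two_colouring red (ground k - red)"
    using red_subset by (auto simp: M.two_colouring_def)
  \<comment> \<open>To the \<open>(k + 2) choose 2\<close> edges the extra point adds one, and three
    red points are removed.\<close>
  show "card (ground k - red) = ((k + 2) choose 2) - 2"
    using card_Diff_subset[OF _ red_subset] card_red card_ground[of k] by (simp add: red_def)
qed (rule simple_ground rank_ground representable card_red rank_blue hyperplane_meets_red
    blue_lines_have_skew_flat)+

end

theorem proposition2p1:
  fixes k :: nat
  assumes "k \<ge> 2"
  shows "b_num k 3 \<ge> ((k + 2) choose 2) - 2"
proof -
  interpret augmented_clique k
    using assms by unfold_locales
  show ?thesis
    using blue_count_example assms by (intro b_num_ge) auto
qed

end
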